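(* Consider biased SGD, $x_{k+1}=x_k-\alpha_k(u_k+e_k)$ with $u_k=\nabla f_{i_k}(x_k)$ and $\|e_k\|^2\le\delta^2\|u_k\|^2+c^2$, applied to $g=\frac1n\sum_{i=1}^n f_i$ with $g\in\mathcal{S}(m,\infty)$ for some $m>0$, and let $x_\star$ be the unique global minimizer of $g$. Suppose that one of the four conditions I–IV on the $f_i$ listed in the context holds, let $M$ and $G$ be the corresponding matrix and constant, and put $\tilde M=M_{11}+2mM_{12}$. Suppose $\alpha_k>0$ and $M_{21}\alpha_k\le1$, with $M_{21}\alpha_k<1$ if $\delta>0$. Let $\zeta_k>0$ satisfy $\zeta_k\ge\tau_k$, where $\tau_k=\frac{\alpha_kM_{21}\delta^2}{1-\alpha_kM_{21}}$ if $\delta>0$ and $\tau_k=0$ if $\delta=0$. Then the numbers $$\mu_k=\alpha_k^2(1+\zeta_k^{-1}),\qquad \lambda_k=\alpha_k^2(1+\zeta_k)(1+\delta^2\zeta_k^{-1}),$$ $$\rho_k^2=(1+\zeta_k)\bigl(1-2m\alpha_k+\tilde M\alpha_k^2(1+\delta^2\zeta_k^{-1})\bigr)$$ are nonnegative, and the biased SGD iterates satisfy $$\mathbb{E}\|x_{k+1}-x_\star\|^2\le\rho_k^2\,\mathbb{E}\|x_k-x_\star\|^2+(2\lambda_kG^2+\mu_kc^2).$$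
   Context: Setting. $p,n\ge1$ are integers, $f_1,\dots,f_n:\mathbb{R}^p\to\mathbb{R}$ are differentiable, and $g(x)=\frac1n\sum_{i=1}^n f_i(x)$. For $m>0$, $g\in\mathcal{S}(m,\infty)$ means that $g$ is differentiable, has a global minimizer $x_\star$, and $(x-x_\star)^{\mathsf T}\nabla g(x)\ge m\|x-x_\star\|^2$ for all $x\in\mathbb{R}^p$ (hence $x_\star$ is the unique minimizer and unique stationary point). Biased SGD. $x_0$ is a random vector with $\mathbb{E}\|x_0\|^2<\infty$, the $\alpha_k$ are deterministic real stepsizes, and $x_{k+1}=x_k-\alpha_k(u_k+e_k)$ with $u_k=\nabla f_{i_k}(x_k)$. The indices $i_k$ are IID uniform on $\{1,\dots,n\}$ and $i_k$ is independent of $x_k$. The $e_k$ are random vectors that are otherwise arbitrary (possibly adversarial) but satisfy $\|e_k\|^2\le\delta^2\|u_k\|^2+c^2$ for every $k$, where $\delta,c\ge0$ are fixed constants. Function class. For $0\le m\le L$, $0<L<\infty$, $\mathcal{F}(m,L)$ is the set of differentiable $f:\mathbb{R}^p\to\mathbb{R}$ with $-2m\|x-y\|^2+2(1+\frac mL)(x-y)^{\mathsf T}(\nabla f(x)-\nabla f(y))-\frac2L\|\nabla f(x)-\nabla f(y)\|^2\ge0$ for all $x,y$. $\mathcal{F}(0,L)$ is the class of convex $L$-smooth functions. A differentiable $f$ is $L$-smooth if $\|\nabla f(x)-\nabla f(y)\|\le L\|x-y\|$ for all $x,y$. The four cases (each condition is required for every $i$; $m$ is the same as in $g\in\mathcal{S}(m,\infty)$;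 $0<L<\infty$, $\beta\ge0$; $G\ge0$): I. $\|\nabla f_i(x)-mx\|\le\beta$ for all $x$; $M=\begin{bmatrix} -m^2 & m \\ m & -1 \end{bmatrix}$, $G^2=\beta^2+m^2\|x_\star\|^2$. II. $f_i$ is $L$-smooth (not necessarily convex); $M=\begin{bmatrix} 2L^2 & 0 \\ 0 & -1 \end{bmatrix}$, $G^2=\frac1n\sum_{i=1}^n\|\nabla f_i(x_\star)\|^2$. III. $f_i\in\mathcal{F}(0,L)$; $M=\begin{bmatrix} 0 & L \\ L & -1 \end{bmatrix}$, $G^2=\frac1n\sum_{i=1}^n\|\nabla f_i(x_\star)\|^2$. IV. $f_i\in\mathcal{F}(m,L)$; $M=\begin{bmatrix} -2mL & L+m \\ L+m & -1 \end{bmatrix}$, $G^2=\frac1n\sum_{i=1}^n\|\nabla f_i(x_\star)\|^2$. Here $M_{ij}$ are the entries of $M$; thus in Cases I, II, III, IV: $M_{21}=m,\,0,\,L,\,L+m$ and $\tilde M=m^2,\,2L^2,\,2mL,\,2m^2$ respectively. *)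

theory Defs
  imports "HOL-Probability.Probability"
begin

text \<open>The gradient is totalised by a definite description; it is meaningful exactly at points of
  differentiability, see \<open>gderiv_grad\<close>.\<close>

definition grad :: "(real ^ 'p \<Rightarrow> real) \<Rightarrow> real ^ 'p \<Rightarrow> real ^ 'p" where
  "grad f x = (THE D. GDERIV f x :> D)"

lemma gderiv_grad:
  fixes f :: "real ^ 'p \<Rightarrow> real"
  assumes "f differentiable (at x)"
  shows "GDERIV f x :> grad f x"
proof -
  from assms obtain f' where f': "(f has_derivative f') (at x)"
    unfolding differentiable_def by blast
  then interpret f': bounded_linear f' by (rule has_derivative_bounded_linear)
  have "f' h = h \<bullet> adjoint f' 1" for h
    using adjoint_works[OF f'.linear_axioms, of h 1] by simp
  then have D: "GDERIV f x :> adjoint f' 1"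
    using f' unfolding gderiv_def by (metis (no_types, lifting) ext)
  moreover have "D' = adjoint f' 1" if "GDERIV f x :> D'" for D'
  proof -
    have "(\<lambda>h. h \<bullet> D') = (\<lambda>h. h \<bullet> adjoint f' 1)"
      using that D has_derivative_unique unfolding gderiv_def by blast
    then show ?thesis by (metis vector_eq_ldot)
  qed
  ultimately show ?thesis unfolding grad_def by (rule theI)
qed

definition global_minimizer :: "(real ^ 'p \<Rightarrow> real) \<Rightarrow> real ^ 'p \<Rightarrow> bool" where
  "global_minimizer g z \<longleftrightarrow> (\<forall>x. g z \<le> g x)"

definition S_class :: "real \<Rightarrow> (real ^ 'p \<Rightarrow> real) set" where
  "S_class m = {g. g differentiable_on UNIV \<and>
     (\<exists>z. global_minimizer g z \<and> (\<forall>x. (x - z) \<bullet> grad g x \<ge> m * (norm (x - z))\<^sup>2))}"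

definition F_class :: "real \<Rightarrow> real \<Rightarrow> (real ^ 'p \<Rightarrow> real) set" where
  "F_class m L = {f. f differentiable_on UNIV \<and>
     (\<forall>x y. - 2 * m * (norm (x - y))\<^sup>2
            + 2 * (1 + m / L) * ((x - y) \<bullet> (grad f x - grad f y))
            - 2 / L * (norm (grad f x - grad f y))\<^sup>2 \<ge> 0)}"

definition L_smooth :: "real \<Rightarrow> (real ^ 'p \<Rightarrow> real) \<Rightarrow> bool" where
  "L_smooth L f \<longleftrightarrow> f differentiable_on UNIV \<and>
     (\<forall>x y. norm (grad f x - grad f y) \<le> L * norm (x - y))"

definition mat2 :: "real \<Rightarrow> real \<Rightarrow> real \<Rightarrow> real \<Rightarrow> real ^ 2 ^ 2" where
  "mat2 a b c d = vector [vector [a, b], vector [c, d]]"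

text \<open>Each case predicate takes \<open>m\<close>, the family \<open>f 1, \<dots>, f n\<close> and the minimizer \<open>z\<close>, and says that
  the condition on the \<open>f i\<close> holds and that \<open>M\<close>, \<open>G\<close> are the matrix and the constant belonging to it.\<close>

definition case_I ::
  "real \<Rightarrow> nat \<Rightarrow> (nat \<Rightarrow> real ^ 'p \<Rightarrow> real) \<Rightarrow> real ^ 'p \<Rightarrow> real ^ 2 ^ 2 \<Rightarrow> real \<Rightarrow> bool" where
  "case_I m n f z M G \<longleftrightarrow> (\<exists>\<beta>\<ge>0.
     (\<forall>i\<in>{1..n}. \<forall>x. norm (grad (f i) x - m *\<^sub>R x) \<le> \<beta>) \<and>
     M = mat2 (- m\<^sup>2) m m (- 1) \<and>
     G \<ge> 0 \<and> G\<^sup>2 = \<beta>\<^sup>2 + m\<^sup>2 * (norm z)\<^sup>2)"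

definition case_II ::
  "real \<Rightarrow> nat \<Rightarrow> (nat \<Rightarrow> real ^ 'p \<Rightarrow> real) \<Rightarrow> real ^ 'p \<Rightarrow> real ^ 2 ^ 2 \<Rightarrow> real \<Rightarrow> bool" where
  "case_II m n f z M G \<longleftrightarrow> (\<exists>L>0.
     (\<forall>i\<in>{1..n}. L_smooth L (f i)) \<and>
     M = mat2 (2 * L\<^sup>2) 0 0 (- 1) \<and>
     G \<ge> 0 \<and> G\<^sup>2 = 1 / real n * (\<Sum>i=1..n. (norm (grad (f i) z))\<^sup>2))"

definition case_III ::
  "real \<Rightarrow> nat \<Rightarrow> (nat \<Rightarrow> real ^ 'p \<Rightarrow> real) \<Rightarrow> real ^ 'p \<Rightarrow> real ^ 2 ^ 2 \<Rightarrow> real \<Rightarrow> bool" where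
  "case_III m n f z M G \<longleftrightarrow> (\<exists>L>0.
     (\<forall>i\<in>{1..n}. f i \<in> F_class 0 L) \<and>
     M = mat2 0 L L (- 1) \<and>
     G \<ge> 0 \<and> G\<^sup>2 = 1 / real n * (\<Sum>i=1..n. (norm (grad (f i) z))\<^sup>2))"

definition case_IV ::
  "real \<Rightarrow> nat \<Rightarrow> (nat \<Rightarrow> real ^ 'p \<Rightarrow> real) \<Rightarrow> real ^ 'p \<Rightarrow> real ^ 2 ^ 2 \<Rightarrow> real \<Rightarrow> bool" where
  "case_IV m n f z M G \<longleftrightarrow> (\<exists>L>0. m \<le> L \<and>
     (\<forall>i\<in>{1..n}. f i \<in> F_class m L) \<and>
     M = mat2 (- 2 * m * L) (L + m) (L + m) (- 1) \<and>
     G \<ge> 0 \<and> G\<^sup>2 = 1 / real n * (\<Sum>i=1..n. (norm (grad (f i) z))\<^sup>2))"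

text \<open>The library's \<open>indep_var\<close> requires both variables to have the same value type, so independence of a
  random vector and a random index is stated through the generated sigma-algebras.\<close>

definition indep_rv ::
  "'w measure \<Rightarrow> 'b measure \<Rightarrow> ('w \<Rightarrow> 'b) \<Rightarrow> 'c measure \<Rightarrow> ('w \<Rightarrow> 'c) \<Rightarrow> bool" where
  "indep_rv P A X B Y \<longleftrightarrow> X \<in> measurable P A \<and> Y \<in> measurable P B \<and>
     prob_space.indep_set P (sets (vimage_algebra (space P) X A)) (sets (vimage_algebra (space P) Y B))"

end

theory Submission
  imports Defs
begin

text \<open>Young's inequality with parameter \<open>\<zeta>\<^sub>k\<close> separates the bias \<open>e\<^sub>k\<close> from the step, and the
  bound on \<open>e\<^sub>k\<close> leaves a quadratic form in \<open>x\<^sub>k - x\<^sub>\<star>\<close> and \<open>u\<^sub>k\<close> in which \<open>\<parallel>u\<^sub>k\<parallel>\<^sup>2\<close> has the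
  coefficient \<open>\<lambda>\<^sub>k\<close>. Averaging over the independent index \<open>i\<^sub>k\<close> replaces the cross term by
  \<open>(x\<^sub>k - x\<^sub>\<star>) \<bullet> \<nabla>g(x\<^sub>k)\<close>, while each of the four cases bounds the mean of \<open>\<parallel>\<nabla>f\<^sub>i(x)\<parallel>\<^sup>2\<close> by
  \<open>M\<^sub>1\<^sub>1 \<parallel>x - x\<^sub>\<star>\<parallel>\<^sup>2 + 2 M\<^sub>1\<^sub>2 (x - x\<^sub>\<star>) \<bullet> \<nabla>g(x) + 2 G\<^sup>2\<close>. The condition \<open>\<zeta>\<^sub>k \<ge> \<tau>\<^sub>k\<close> says that the
  resulting coefficient of \<open>(x - x\<^sub>\<star>) \<bullet> \<nabla>g(x)\<close> is nonpositive, so this term can be eliminated by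
  \<open>(x - x\<^sub>\<star>) \<bullet> \<nabla>g(x) \<ge> m \<parallel>x - x\<^sub>\<star>\<parallel>\<^sup>2\<close>. Nonnegativity of \<open>\<rho>\<^sub>k\<^sup>2\<close> follows from \<open>M\<^sub>1\<^sub>1 + 2 m M\<^sub>1\<^sub>2 \<ge> m\<^sup>2\<close>,
  which in Cases II and III rests on \<open>m \<le> L\<close>.\<close>

section \<open>Gradients: averages, stationarity at the minimizer, measurability\<close>

lemma grad_eqI: "GDERIV f x :> D \<Longrightarrow> grad f x = D"
  by (metis gderiv_def gderiv_grad differentiableI has_derivative_unique vector_eq_ldot)

lemma grad_mean:
  fixes f :: "nat \<Rightarrow> real ^ 'p \<Rightarrow> real"
  assumes diff: "\<forall>i\<in>{1..n}. f i differentiable_on UNIV"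
    and g: "\<forall>y. g y = 1 / real n * (\<Sum>i=1..n. f i y)"
  shows "grad g y = (1 / real n) *\<^sub>R (\<Sum>i=1..n. grad (f i) y)"
proof -
  have D: "(f i has_derivative (\<lambda>h. h \<bullet> grad (f i) y)) (at y)" if "i \<in> {1..n}" for i
    using that diff gderiv_grad[of "f i" y] unfolding gderiv_def differentiable_on_def by auto
  have "((\<lambda>y. 1 / real n * (\<Sum>i=1..n. f i y)) has_derivative
      (\<lambda>h. 1 / real n * (\<Sum>i=1..n. h \<bullet> grad (f i) y))) (at y)"
    by (intro has_derivative_mult_right has_derivative_sum D)
  moreover have "g = (\<lambda>y. 1 / real n * (\<Sum>i=1..n. f i y))"
    using g by auto
  ultimately show ?thesis
    by (intro grad_eqI) (simp add: gderiv_def inner_sum_right)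
qed

lemma grad_global_minimizer:
  fixes g :: "real ^ 'p \<Rightarrow> real"
  assumes "g differentiable_on UNIV" "global_minimizer g z"
  shows "grad g z = 0"
proof -
  have D: "(g has_derivative (\<lambda>h. h \<bullet> grad g z)) (at z)"
    using assms(1) gderiv_grad[of g z] unfolding gderiv_def differentiable_on_def by auto
  have "(\<lambda>h. h \<bullet> grad g z) = (\<lambda>h. 0)"
    by (rule differential_zero_maxmin[of z UNIV g]) (use D assms(2) in \<open>auto simp: global_minimizer_def\<close>)
  then have "grad g z \<bullet> grad g z = 0"
    by metis
  then show ?thesis by simp
qed

text \<open>Membership in \<open>S_class m\<close> only provides some minimizer \<open>w\<close>.
  Since \<open>grad g z = 0\<close>, the inequality around \<open>w\<close> evaluated at
  \<open>z\<close> forces \<open>z = w\<close>, so it holds around every prescribed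
  minimizer.\<close>

lemma S_class_global_minimizer:
  fixes g :: "real ^ 'p \<Rightarrow> real"
  assumes g: "g \<in> S_class m" and m: "m > 0" and z: "global_minimizer g z"
  shows "m * (norm (y - z))\<^sup>2 \<le> (y - z) \<bullet> grad g y"
proof -
  obtain w where w: "\<forall>x. (x - w) \<bullet> grad g x \<ge> m * (norm (x - w))\<^sup>2"
    and d: "g differentiable_on UNIV"
    using g unfolding S_class_def by auto
  have "m * (norm (z - w))\<^sup>2 \<le> 0"
    using w[rule_format, of z] grad_global_minimizer[OF d z] by simp
  then have "z = w" using m by (simp add: mult_le_0_iff)
  then show ?thesis using w by simp
qed

text \<open>Differentiability alone does not make the gradient continuous. Each component is,
  however, the pointwise limit of difference quotients with step
  \<open>inverse (real (Suc n))\<close>, which are continuous in the base point.\<close>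

lemma borel_measurable_grad:
  fixes f :: "real ^ 'p \<Rightarrow> real"
  assumes diff: "f differentiable_on UNIV"
  shows "grad f \<in> borel_measurable borel"
proof -
  have cont: "continuous_on UNIV f"
    using diff by (rule differentiable_imp_continuous_on)
  have "(\<lambda>y. grad f y \<bullet> b) \<in> borel_measurable borel" for b
  proof (rule borel_measurable_LIMSEQ_real)
    fix y
    have D: "(f has_derivative (\<lambda>h. h \<bullet> grad f y)) (at (y + 0 *\<^sub>R b))"
      using diff gderiv_grad[of f y] unfolding gderiv_def differentiable_on_def by auto
    have "((\<lambda>t. y + t *\<^sub>R b) has_derivative (\<lambda>t. t *\<^sub>R b)) (at 0)"
      by (auto intro!: derivative_eq_intros)
    from has_derivative_compose[OF this D]
    have "((\<lambda>t. f (y + t *\<^sub>R b)) has_real_derivative (grad f y \<bullet> b)) (at 0)"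
      by (simp add: has_field_derivative_def inner_commute[of b] mult.commute[of _ "_ \<bullet> b"])
    then have "(\<lambda>h. (f (y + h *\<^sub>R b) - f y) / h) \<midarrow>0\<rightarrow> grad f y \<bullet> b"
      by (simp add: DERIV_def)
    moreover have "filterlim (\<lambda>n. inverse (real (Suc n))) (at 0) sequentially"
      using LIMSEQ_inverse_real_of_nat by (auto simp: filterlim_at)
    ultimately show "(\<lambda>n. (f (y + inverse (real (Suc n)) *\<^sub>R b) - f y) / inverse (real (Suc n)))
        \<longlonglongrightarrow> grad f y \<bullet> b"
      by (rule filterlim_compose)
  next
    fix n
    have "continuous_on UNIV (\<lambda>y. (f (y + inverse (real (Suc n)) *\<^sub>R b) - f y) / inverse (real (Suc n)))"
      by (intro continuous_intros continuous_on_compose2[OF cont] cont) auto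
    then show "(\<lambda>y. (f (y + inverse (real (Suc n)) *\<^sub>R b) - f y) / inverse (real (Suc n)))
        \<in> borel_measurable borel"
      by (rule borel_measurable_continuous_onI)
  qed
  then show ?thesis
    by (subst borel_measurable_euclidean_space) auto
qed

section \<open>Young-type inequalities and second-moment bounds for the component gradients\<close>

lemma norm_add_sq_le:
  fixes a b :: "'a::real_inner"
  shows "(norm (a + b))\<^sup>2 \<le> 2 * (norm a)\<^sup>2 + 2 * (norm b)\<^sup>2"
proof -
  have "2 * (norm a)\<^sup>2 + 2 * (norm b)\<^sup>2 - (norm (a + b))\<^sup>2 = (norm (a - b))\<^sup>2"
    by (simp add: power2_norm_eq_inner algebra_simps inner_commute)
  then show ?thesis by (smt (verit) zero_le_power2)
qed

lemma norm_diff_scaled_sq: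
  fixes a b :: "'a::real_inner"
  shows "(norm (a - t *\<^sub>R b))\<^sup>2 = (norm a)\<^sup>2 - 2 * t * (a \<bullet> b) + t\<^sup>2 * (norm b)\<^sup>2"
  unfolding power2_norm_eq_inner
  by (simp add: inner_diff_left inner_diff_right inner_commute[of b a] power2_eq_square right_diff_distrib)

lemma norm_diff_scaled_sq_le:
  fixes a b :: "'a::real_inner"
  assumes "\<zeta> > 0"
  shows "(norm (a - \<alpha> *\<^sub>R b))\<^sup>2 \<le> (1 + \<zeta>) * (norm a)\<^sup>2 + \<alpha>\<^sup>2 * (1 + inverse \<zeta>) * (norm b)\<^sup>2"
proof -
  \<comment> \<open>The gap in Young's inequality is a scaled perfect square, that of
    \<open>\<zeta> *\<^sub>R a + \<alpha> *\<^sub>R b\<close>; the double minus sign lets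
    \<open>norm_diff_scaled_sq\<close> expand it.\<close>
  have "0 \<le> inverse \<zeta> * (norm (\<zeta> *\<^sub>R a - (- \<alpha>) *\<^sub>R b))\<^sup>2"
    using assms by simp
  also have "\<dots> = (1 + \<zeta>) * (norm a)\<^sup>2 + \<alpha>\<^sup>2 * (1 + inverse \<zeta>) * (norm b)\<^sup>2 - (norm (a - \<alpha> *\<^sub>R b))\<^sup>2"
    unfolding norm_diff_scaled_sq using assms by (simp add: field_simps power2_eq_square)
  finally show ?thesis by simp
qed

text \<open>Here \<open>a\<close>, \<open>b\<close> play the roles of \<open>M\<^sub>1\<^sub>1\<close> and \<open>M\<^sub>1\<^sub>2\<close>; the hypothesis is the common form of
  the conditions in Cases II to IV.\<close>

lemma sum_norm_sq_le_of_incremental: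
  fixes F :: "nat \<Rightarrow> 'a::real_inner \<Rightarrow> 'a"
  assumes n: "n \<ge> 1"
    and zero: "(\<Sum>i=1..n. F i z) = 0"
    and inc: "\<And>i y. i \<in> {1..n} \<Longrightarrow>
      2 * (norm (F i y - F i z))\<^sup>2 \<le> a * (norm (y - z))\<^sup>2 + 2 * b * ((y - z) \<bullet> (F i y - F i z))"
    and G: "G\<^sup>2 = 1 / real n * (\<Sum>i=1..n. (norm (F i z))\<^sup>2)"
  shows "(\<Sum>i=1..n. (norm (F i y))\<^sup>2)
    \<le> real n * (a * (norm (y - z))\<^sup>2 + 2 * G\<^sup>2) + 2 * b * ((y - z) \<bullet> (\<Sum>i=1..n. F i y))"
proof -
  have "(\<Sum>i=1..n. (norm (F i y))\<^sup>2) \<le> (\<Sum>i=1..n. a * (norm (y - z))\<^sup>2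
      + 2 * b * ((y - z) \<bullet> (F i y - F i z)) + 2 * (norm (F i z))\<^sup>2)"
  proof (rule sum_mono)
    fix i assume "i \<in> {1..n}"
    then show "(norm (F i y))\<^sup>2 \<le> a * (norm (y - z))\<^sup>2
      + 2 * b * ((y - z) \<bullet> (F i y - F i z)) + 2 * (norm (F i z))\<^sup>2"
      using inc[of i y] norm_add_sq_le[of "F i y - F i z" "F i z"] by simp
  qed
  also have "\<dots> = real n * (a * (norm (y - z))\<^sup>2) + 2 * b * ((y - z) \<bullet> (\<Sum>i=1..n. F i y - F i z))
      + 2 * (\<Sum>i=1..n. (norm (F i z))\<^sup>2)"
    by (simp add: sum.distrib sum_distrib_left inner_sum_right)
  also have "(\<Sum>i=1..n. F i y - F i z) = (\<Sum>i=1..n. F i y)"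
    using zero by (simp add: sum_subtractf)
  also have "(\<Sum>i=1..n. (norm (F i z))\<^sup>2) = real n * G\<^sup>2"
    using G n by simp
  finally show ?thesis by (simp add: algebra_simps)
qed

text \<open>Quadratic growth is what later keeps all second moments finite. The cross term has no
  sign, so it is absorbed by completing the square with \<open>b *\<^sub>R (y - z)\<close>; this
  uses up one of the two copies of the squared increment in the hypothesis.\<close>

lemma norm_sq_growth_of_incremental:
  fixes F :: "nat \<Rightarrow> 'a::real_inner \<Rightarrow> 'a"
  assumes inc: "\<And>i y. i \<in> {1..n} \<Longrightarrow>
      2 * (norm (F i y - F i z))\<^sup>2 \<le> a * (norm (y - z))\<^sup>2 + 2 * b * ((y - z) \<bullet> (F i y - F i z))"
  shows "\<exists>A B. \<forall>i\<in>{1..n}. \<forall>y. (norm (F i y))\<^sup>2 \<le> A * (norm (y - z))\<^sup>2 + B"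
proof (intro exI ballI allI)
  fix i y assume i: "i \<in> {1..n}"
  have "0 \<le> (norm ((F i y - F i z) - b *\<^sub>R (y - z)))\<^sup>2" by simp
  also have "\<dots> = b\<^sup>2 * (norm (y - z))\<^sup>2 - 2 * b * ((y - z) \<bullet> (F i y - F i z)) + (norm (F i y - F i z))\<^sup>2"
    unfolding norm_diff_scaled_sq inner_commute[of "F i y - F i z"] by simp
  finally have "(norm (F i y - F i z))\<^sup>2 \<le> (a + b\<^sup>2) * (norm (y - z))\<^sup>2"
    using inc[OF i, of y] by (simp add: algebra_simps)
  moreover have "(norm (F i z))\<^sup>2 \<le> (\<Sum>j=1..n. (norm (F j z))\<^sup>2)"
    using i by (intro member_le_sum) auto
  ultimately show "(norm (F i y))\<^sup>2
      \<le> 2 * (a + b\<^sup>2) * (norm (y - z))\<^sup>2 + 2 * (\<Sum>j=1..n. (norm (F j z))\<^sup>2)"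
    using norm_add_sq_le[of "F i y - F i z" "F i z"] by (simp add: distrib_right)
qed

text \<open>At distance 1 from \<open>z\<close>, monotonicity of the mean field bounds the average
  radial increment below by \<open>m\<close>, while Cauchy-Schwarz bounds each increment above by
  \<open>L\<close>.\<close>

lemma le_lipschitz_constant_of_monotone:
  fixes F :: "nat \<Rightarrow> real ^ 'p \<Rightarrow> real ^ 'p"
  assumes n: "n \<ge> 1"
    and zero: "(\<Sum>i=1..n. F i z) = 0"
    and mono: "\<And>y. real n * (m * (norm (y - z))\<^sup>2) \<le> (y - z) \<bullet> (\<Sum>i=1..n. F i y)"
    and lip: "\<And>i y. i \<in> {1..n} \<Longrightarrow> norm (F i y - F i z) \<le> L * norm (y - z)"
  shows "m \<le> L"
proof -
  \<comment> \<open>A unit vector exists because the index type \<open>'p\<close> is nonempty, i.e.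
    the dimension is at least 1.\<close>
  obtain v :: "real ^ 'p" where v: "norm v = 1"
    using vector_choose_size[of 1] by auto
  have "real n * m \<le> v \<bullet> (\<Sum>i=1..n. F i (z + v) - F i z)"
    using mono[of "z + v"] v zero by (simp add: sum_subtractf)
  also have "\<dots> = (\<Sum>i=1..n. v \<bullet> (F i (z + v) - F i z))"
    by (simp add: inner_sum_right)
  also have "\<dots> \<le> (\<Sum>i=1..n. L)"
  proof (rule sum_mono)
    fix i assume "i \<in> {1..n}"
    then show "v \<bullet> (F i (z + v) - F i z) \<le> L"
      using norm_cauchy_schwarz[of v "F i (z + v) - F i z"] lip[of i "z + v"] v by simp
  qed
  finally show ?thesis using n by simp
qed

lemma mat2_nth [simp]:
  "mat2 a b c d $ 1 $ 1 = a" "mat2 a b c d $ 1 $ 2 = b"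
  "mat2 a b c d $ 2 $ 1 = c" "mat2 a b c d $ 2 $ 2 = d"
  by (simp_all add: mat2_def)

text \<open>The four cases are merged here, so that the recursion is proved once in terms of the
  entries of \<open>M\<close>. Cases II to IV go through an incremental bound around
  \<open>z\<close>; Case I compares each gradient with \<open>m *\<^sub>R (y - z)\<close>. The
  quantity compared with \<open>m\<^sup>2\<close> equals \<open>m\<^sup>2\<close>,
  \<open>2 * L\<^sup>2\<close>, \<open>2 * m * L\<close> and \<open>2 * m\<^sup>2\<close> in
  turn.\<close>

lemma case_bounds:
  fixes f :: "nat \<Rightarrow> real ^ 'p \<Rightarrow> real"
  assumes n: "n \<ge> 1" and m: "m > 0"
    and zero: "(\<Sum>i=1..n. grad (f i) z) = 0"
    and mono: "\<And>y. real n * (m * (norm (y - z))\<^sup>2) \<le> (y - z) \<bullet> (\<Sum>i=1..n. grad (f i) y)"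
    and cases: "case_I m n f z M G \<or> case_II m n f z M G \<or> case_III m n f z M G \<or> case_IV m n f z M G"
  shows case_symmetric: "M $ 2 $ 1 = M $ 1 $ 2"
    and case_Mt_ge: "m\<^sup>2 \<le> M $ 1 $ 1 + 2 * m * M $ 1 $ 2"
    and case_sum_norm_sq_le: "\<And>y. (\<Sum>i=1..n. (norm (grad (f i) y))\<^sup>2)
      \<le> real n * (M $ 1 $ 1 * (norm (y - z))\<^sup>2 + 2 * G\<^sup>2)
        + 2 * M $ 1 $ 2 * ((y - z) \<bullet> (\<Sum>i=1..n. grad (f i) y))"
    and case_growth: "\<exists>A B. \<forall>i\<in>{1..n}. \<forall>y. (norm (grad (f i) y))\<^sup>2 \<le> A * (norm (y - z))\<^sup>2 + B"
proof -
  have "M $ 2 $ 1 = M $ 1 $ 2 \<and> m\<^sup>2 \<le> M $ 1 $ 1 + 2 * m * M $ 1 $ 2 \<and>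
    (\<forall>y. (\<Sum>i=1..n. (norm (grad (f i) y))\<^sup>2)
      \<le> real n * (M $ 1 $ 1 * (norm (y - z))\<^sup>2 + 2 * G\<^sup>2)
        + 2 * M $ 1 $ 2 * ((y - z) \<bullet> (\<Sum>i=1..n. grad (f i) y))) \<and>
    (\<exists>A B. \<forall>i\<in>{1..n}. \<forall>y. (norm (grad (f i) y))\<^sup>2 \<le> A * (norm (y - z))\<^sup>2 + B)"
    (is "?sym \<and> ?Mt \<and> ?sum \<and> ?growth")
    using cases
  proof (elim disjE)
    assume "case_I m n f z M G"
    then obtain \<beta> where b: "\<forall>i\<in>{1..n}. \<forall>x. norm (grad (f i) x - m *\<^sub>R x) \<le> \<beta>"
      and M: "M = mat2 (- m\<^sup>2) m m (- 1)" and G: "G\<^sup>2 = \<beta>\<^sup>2 + m\<^sup>2 * (norm z)\<^sup>2"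
      unfolding case_I_def by blast
    \<comment> \<open>Recentring from the origin to \<open>z\<close> adds
      \<open>m *\<^sub>R z\<close> to the deviation, which is where the term
      \<open>m\<^sup>2 * (norm z)\<^sup>2\<close> of \<open>G\<^sup>2\<close> comes from.\<close>
    have dev: "(norm (grad (f i) y - m *\<^sub>R (y - z)))\<^sup>2 \<le> 2 * G\<^sup>2" if "i \<in> {1..n}" for i y
    proof -
      have "(norm (grad (f i) y - m *\<^sub>R y))\<^sup>2 \<le> \<beta>\<^sup>2"
        using b that by (intro power_mono) auto
      then show ?thesis
        using norm_add_sq_le[of "grad (f i) y - m *\<^sub>R y" "m *\<^sub>R z"] G
        by (simp add: algebra_simps power_mult_distrib)
    qed
    have ?sum
    proof
      fix y
      have "(\<Sum>i=1..n. (norm (grad (f i) y))\<^sup>2)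
        \<le> (\<Sum>i=1..n. - m\<^sup>2 * (norm (y - z))\<^sup>2 + 2 * G\<^sup>2 + 2 * m * ((y - z) \<bullet> grad (f i) y))"
      proof (rule sum_mono)
        fix i assume i: "i \<in> {1..n}"
        \<comment> \<open>Expanding the square controlled by \<open>dev\<close> produces the entries
          \<open>- m\<^sup>2\<close> and \<open>m\<close> of \<open>M\<close>.\<close>
        have "(norm (grad (f i) y - m *\<^sub>R (y - z)))\<^sup>2
          = (norm (grad (f i) y))\<^sup>2 - 2 * m * ((y - z) \<bullet> grad (f i) y) + m\<^sup>2 * (norm (y - z))\<^sup>2"
          unfolding norm_diff_scaled_sq inner_commute[of "grad (f i) y"] by simp
        then show "(norm (grad (f i) y))\<^sup>2
          \<le> - m\<^sup>2 * (norm (y - z))\<^sup>2 + 2 * G\<^sup>2 + 2 * m * ((y - z) \<bullet> grad (f i) y)"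
          using dev[OF i, of y] by simp
      qed
      then show "(\<Sum>i=1..n. (norm (grad (f i) y))\<^sup>2)
        \<le> real n * (M $ 1 $ 1 * (norm (y - z))\<^sup>2 + 2 * G\<^sup>2)
          + 2 * M $ 1 $ 2 * ((y - z) \<bullet> (\<Sum>i=1..n. grad (f i) y))"
        unfolding M mat2_nth inner_sum_right sum_distrib_left by (simp add: sum.distrib distrib_left)
    qed
    moreover have "(norm (grad (f i) y))\<^sup>2 \<le> (2 * m\<^sup>2) * (norm (y - z))\<^sup>2 + 4 * G\<^sup>2"
      if "i \<in> {1..n}" for i y
      using norm_add_sq_le[of "grad (f i) y - m *\<^sub>R (y - z)" "m *\<^sub>R (y - z)"] dev[OF that, of y]
      by (simp add: power_mult_distrib)
    then have ?growth by blast
    ultimately show ?thesis by (simp add: M power2_eq_square)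
  next
    assume "case_II m n f z M G"
    then obtain L where L: "L > 0" and s: "\<forall>i\<in>{1..n}. L_smooth L (f i)"
      and M: "M = mat2 (2 * L\<^sup>2) 0 0 (- 1)"
      and G: "G\<^sup>2 = 1 / real n * (\<Sum>i=1..n. (norm (grad (f i) z))\<^sup>2)"
      unfolding case_II_def by blast
    have lip: "norm (grad (f i) y - grad (f i) z) \<le> L * norm (y - z)" if "i \<in> {1..n}" for i y
      using s that unfolding L_smooth_def by blast
    have inc: "2 * (norm (grad (f i) y - grad (f i) z))\<^sup>2 \<le> (2 * L\<^sup>2) * (norm (y - z))\<^sup>2
        + 2 * 0 * ((y - z) \<bullet> (grad (f i) y - grad (f i) z))" if "i \<in> {1..n}" for i y
      using power_mono[OF lip[OF that, of y], of 2] by (simp add: power_mult_distrib)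
    have "m \<le> L"
      by (rule le_lipschitz_constant_of_monotone[where F = "\<lambda>i. grad (f i)", OF n zero mono lip])
    then have "m\<^sup>2 \<le> L\<^sup>2" using m by (intro power_mono) auto
    then have ?Mt by (simp add: M) (smt (verit) zero_le_power2)
    then show ?thesis
      using sum_norm_sq_le_of_incremental[where F = "\<lambda>i. grad (f i)", OF n zero inc G]
        norm_sq_growth_of_incremental[where F = "\<lambda>i. grad (f i)", OF inc]
      by (simp add: M)
  next
    assume "case_III m n f z M G"
    then obtain L where L: "L > 0" and s: "\<forall>i\<in>{1..n}. f i \<in> F_class 0 L"
      and M: "M = mat2 0 L L (- 1)"
      and G: "G\<^sup>2 = 1 / real n * (\<Sum>i=1..n. (norm (grad (f i) z))\<^sup>2)"
      unfolding case_III_def by blast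
    have inc: "2 * (norm (grad (f i) y - grad (f i) z))\<^sup>2 \<le> 0 * (norm (y - z))\<^sup>2
        + 2 * L * ((y - z) \<bullet> (grad (f i) y - grad (f i) z))" if "i \<in> {1..n}" for i y
    proof -
      have "f i \<in> F_class 0 L" using s that by blast
      then have "0 \<le> 2 * ((y - z) \<bullet> (grad (f i) y - grad (f i) z))
          - 2 / L * (norm (grad (f i) y - grad (f i) z))\<^sup>2"
        unfolding F_class_def by (auto dest!: spec[of _ y] spec[of _ z])
      then show ?thesis using L by (simp add: field_simps)
    qed
    \<comment> \<open>Cocoercivity and Cauchy-Schwarz give the Lipschitz bound after cancelling one
      factor \<open>norm ?d\<close>; the case \<open>norm ?d = 0\<close> is separate.\<close>
    have lip: "norm (grad (f i) y - grad (f i) z) \<le> L * norm (y - z)" if i: "i \<in> {1..n}" for i y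
    proof -
      let ?d = "grad (f i) y - grad (f i) z"
      have "norm ?d * norm ?d \<le> L * ((y - z) \<bullet> ?d)"
        using inc[OF i, of y] by (simp add: power2_eq_square)
      also have "\<dots> \<le> L * (norm (y - z) * norm ?d)"
        using L norm_cauchy_schwarz[of "y - z" ?d] by (intro mult_left_mono) auto
      finally have "norm ?d * norm ?d \<le> (L * norm (y - z)) * norm ?d" by simp
      then show ?thesis
        using L by (cases "norm ?d = 0") (auto simp: mult_le_cancel_right)
    qed
    have "m \<le> L"
      by (rule le_lipschitz_constant_of_monotone[where F = "\<lambda>i. grad (f i)", OF n zero mono lip])
    then have "m * m \<le> m * L" using m by (intro mult_left_mono) auto
    then have ?Mt using m L by (simp add: M power2_eq_square)
    then show ?thesis
      using sum_norm_sq_le_of_incremental[where F = "\<lambda>i. grad (f i)", OF n zero inc G]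
        norm_sq_growth_of_incremental[where F = "\<lambda>i. grad (f i)", OF inc]
      by (simp add: M)
  next
    assume "case_IV m n f z M G"
    then obtain L where L: "L > 0" and s: "\<forall>i\<in>{1..n}. f i \<in> F_class m L"
      and M: "M = mat2 (- 2 * m * L) (L + m) (L + m) (- 1)"
      and G: "G\<^sup>2 = 1 / real n * (\<Sum>i=1..n. (norm (grad (f i) z))\<^sup>2)"
      unfolding case_IV_def by blast
    have inc: "2 * (norm (grad (f i) y - grad (f i) z))\<^sup>2 \<le> (- 2 * m * L) * (norm (y - z))\<^sup>2
        + 2 * (L + m) * ((y - z) \<bullet> (grad (f i) y - grad (f i) z))" if "i \<in> {1..n}" for i y
    proof -
      have "f i \<in> F_class m L" using s that by blast
      then have "0 \<le> - 2 * m * (norm (y - z))\<^sup>2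
          + 2 * (1 + m / L) * ((y - z) \<bullet> (grad (f i) y - grad (f i) z))
          - 2 / L * (norm (grad (f i) y - grad (f i) z))\<^sup>2"
        unfolding F_class_def by blast
      \<comment> \<open>Multiplying by \<open>L\<close> clears the denominators and turns
        \<open>1 + m / L\<close> into the entry \<open>L + m\<close>.\<close>
      from mult_left_mono[OF this less_imp_le[OF L]] show ?thesis
        using L by (simp add: distrib_left right_diff_distrib distrib_right mult.assoc mult.left_commute)
    qed
    have ?Mt by (simp add: M power2_eq_square algebra_simps)
    then show ?thesis
      using sum_norm_sq_le_of_incremental[where F = "\<lambda>i. grad (f i)", OF n zero inc G]
        norm_sq_growth_of_incremental[where F = "\<lambda>i. grad (f i)", OF inc]
      by (simp add: M)
  qed
  then show "M $ 2 $ 1 = M $ 1 $ 2" "m\<^sup>2 \<le> M $ 1 $ 1 + 2 * m * M $ 1 $ 2"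
    "\<And>y. (\<Sum>i=1..n. (norm (grad (f i) y))\<^sup>2)
      \<le> real n * (M $ 1 $ 1 * (norm (y - z))\<^sup>2 + 2 * G\<^sup>2)
        + 2 * M $ 1 $ 2 * ((y - z) \<bullet> (\<Sum>i=1..n. grad (f i) y))"
    "\<exists>A B. \<forall>i\<in>{1..n}. \<forall>y. (norm (grad (f i) y))\<^sup>2 \<le> A * (norm (y - z))\<^sup>2 + B"
    by blast+
qed

section \<open>Averaging over an independent uniform index\<close>

text \<open>No conditional expectation is needed, because the index takes finitely many values: the
  random choice is a finite sum of indicators \<open>J i\<close> times
  \<open>\<Phi> i (X \<omega>)\<close>. Each product has independent real factors, and each
  indicator has mean \<open>1 / real n\<close>.\<close>

lemma (in prob_space) integral_indep_uniform_index:
  fixes \<Phi> :: "nat \<Rightarrow> 'b \<Rightarrow> real"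
  assumes n: "n \<ge> 1"
    and indep: "indep_rv M B X (count_space {1..n}) I"
    and dist: "distr M (count_space {1..n}) I = uniform_count_measure {1..n}"
    and meas: "\<And>i. i \<in> {1..n} \<Longrightarrow> \<Phi> i \<in> borel_measurable B"
    and int: "\<And>i. i \<in> {1..n} \<Longrightarrow> integrable M (\<lambda>\<omega>. \<Phi> i (X \<omega>))"
  shows "integrable M (\<lambda>\<omega>. \<Phi> (I \<omega>) (X \<omega>))"
    and "expectation (\<lambda>\<omega>. \<Phi> (I \<omega>) (X \<omega>)) = expectation (\<lambda>\<omega>. 1 / real n * (\<Sum>i=1..n. \<Phi> i (X \<omega>)))"
proof -
  have X: "X \<in> measurable M B" and I: "I \<in> measurable M (count_space {1..n})"
    and ind: "indep_set (sets (vimage_algebra (space M) X B))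
      (sets (vimage_algebra (space M) I (count_space {1..n})))"
    using indep unfolding indep_rv_def by auto
  define J where "J i \<omega> = (if I \<omega> = i then 1 else 0 :: real)" for i \<omega>
  have Jm: "J i \<in> borel_measurable M" for i
  proof -
    have "(\<lambda>j. if j = i then 1 else 0 :: real) \<in> measurable (count_space {1..n}) borel" by simp
    from measurable_compose[OF I this] show ?thesis by (simp add: J_def[abs_def])
  qed
  have iv: "indep_var borel (J i) borel (\<lambda>\<omega>. \<Phi> i (X \<omega>))" if i: "i \<in> {1..n}" for i
    unfolding indep_var_eq
  proof (intro conjI)
    show "random_variable borel (J i)" by (rule Jm)
    show Pm: "random_variable borel (\<lambda>\<omega>. \<Phi> i (X \<omega>))"
      by (rule measurable_compose[OF X meas[OF i]])
    let ?SX = "sets (vimage_algebra (space M) X B)"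
    let ?SI = "sets (vimage_algebra (space M) I (count_space {1..n}))"
    have Xs: "X \<in> space M \<rightarrow> space B" using X by (rule measurable_space[THEN funcsetI])
    have Is: "I \<in> space M \<rightarrow> {1..n}" using measurable_space[OF I] by auto
    \<comment> \<open>Measurable functions of \<open>X\<close> and of \<open>I\<close> generate
      smaller sigma-algebras, and independence passes to these.\<close>
    have A: "sigma_sets (space M) {(\<lambda>\<omega>. \<Phi> i (X \<omega>)) -` A \<inter> space M |A. A \<in> sets borel} \<subseteq> ?SX"
    proof -
      have "(\<lambda>\<omega>. \<Phi> i (X \<omega>)) \<in> measurable (vimage_algebra (space M) X B) borel"
        by (rule measurable_compose[OF measurable_vimage_algebra1[OF Xs] meas[OF i]])
      from sets.sigma_sets_subset[of _ "vimage_algebra (space M) X B"] measurable_sets[OF this]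
      show ?thesis by (smt (verit, best) mem_Collect_eq space_vimage_algebra subsetI)
    qed
    have B: "sigma_sets (space M) {J i -` A \<inter> space M |A. A \<in> sets borel} \<subseteq> ?SI"
    proof -
      have "(\<lambda>j. if j = i then 1 else 0 :: real) \<in> measurable (count_space {1..n}) borel" by simp
      moreover have "I \<in> measurable (vimage_algebra (space M) I (count_space {1..n})) (count_space {1..n})"
        by (rule measurable_vimage_algebra1) (use Is in simp)
      ultimately have "J i \<in> measurable (vimage_algebra (space M) I (count_space {1..n})) borel"
        unfolding J_def[abs_def] by (rule measurable_compose[rotated])
      from sets.sigma_sets_subset[of _ "vimage_algebra (space M) I (count_space {1..n})"] measurable_sets[OF this]
      show ?thesis by (smt (verit, best) mem_Collect_eq space_vimage_algebra subsetI)
    qed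
    \<comment> \<open>The order is swapped because the indicator is the first factor of the
      product.\<close>
    have "indep_set ?SI ?SX"
      using ind unfolding indep_sets2_eq by (metis (no_types, lifting) Int_commute mult.commute)
    then show "indep_set (sigma_sets (space M) {J i -` A \<inter> space M |A. A \<in> sets borel})
        (sigma_sets (space M) {(\<lambda>\<omega>. \<Phi> i (X \<omega>)) -` A \<inter> space M |A. A \<in> sets borel})"
      using A B unfolding indep_sets2_eq by blast
  qed
  have Jint: "integrable M (J i)" for i
    by (rule integrable_const_bound[where B = 1]) (use Jm in \<open>auto simp: J_def\<close>)
  have EJ: "expectation (J i) = 1 / real n" if i: "i \<in> {1..n}" for i
  proof -
    have "expectation (J i) = integral\<^sup>L (distr M (count_space {1..n}) I) (\<lambda>j. if j = i then 1 else 0)"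
      by (subst integral_distr[OF I]) (auto simp: J_def[abs_def])
    also have "\<dots> = 1 / real n"
      unfolding dist using i n by (subst integral_uniform_count_measure) auto
    finally show ?thesis .
  qed
  have eq: "\<Phi> (I \<omega>) (X \<omega>) = (\<Sum>i=1..n. J i \<omega> * \<Phi> i (X \<omega>))" if "\<omega> \<in> space M" for \<omega>
  proof -
    have "I \<omega> \<in> {1..n}" using measurable_space[OF I that] by simp
    then show ?thesis unfolding J_def by (simp add: if_distrib[of "\<lambda>t. t * _"] cong: if_cong)
  qed
  have pint: "integrable M (\<lambda>\<omega>. J i \<omega> * \<Phi> i (X \<omega>))" if i: "i \<in> {1..n}" for i
    by (rule indep_var_integrable[OF iv[OF i] Jint int[OF i]])
  show "integrable M (\<lambda>\<omega>. \<Phi> (I \<omega>) (X \<omega>))"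
    by (subst Bochner_Integration.integrable_cong[OF refl eq])
      (auto intro!: Bochner_Integration.integrable_sum pint)
  have "expectation (\<lambda>\<omega>. \<Phi> (I \<omega>) (X \<omega>)) = expectation (\<lambda>\<omega>. \<Sum>i=1..n. J i \<omega> * \<Phi> i (X \<omega>))"
    by (rule Bochner_Integration.integral_cong[OF refl eq])
  also have "\<dots> = (\<Sum>i=1..n. expectation (\<lambda>\<omega>. J i \<omega> * \<Phi> i (X \<omega>)))"
    by (rule Bochner_Integration.integral_sum[OF pint])
  also have "\<dots> = (\<Sum>i=1..n. 1 / real n * expectation (\<lambda>\<omega>. \<Phi> i (X \<omega>)))"
    by (intro sum.cong refl) (simp only: indep_var_lebesgue_integral[OF iv Jint int] EJ)
  also have "\<dots> = 1 / real n * (\<Sum>i=1..n. expectation (\<lambda>\<omega>. \<Phi> i (X \<omega>)))"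
    by (simp only: sum_distrib_left)
  also have "(\<Sum>i=1..n. expectation (\<lambda>\<omega>. \<Phi> i (X \<omega>))) = expectation (\<lambda>\<omega>. \<Sum>i=1..n. \<Phi> i (X \<omega>))"
    by (rule Bochner_Integration.integral_sum[OF int, symmetric])
  finally show "expectation (\<lambda>\<omega>. \<Phi> (I \<omega>) (X \<omega>)) = expectation (\<lambda>\<omega>. 1 / real n * (\<Sum>i=1..n. \<Phi> i (X \<omega>)))"
    by (simp only: integral_mult_right_zero)
qed

section \<open>The one-step recursion for biased SGD\<close>

theorem corollary1:
  fixes n :: nat
    and f :: "nat \<Rightarrow> real ^ 'p \<Rightarrow> real" and g :: "real ^ 'p \<Rightarrow> real" and xs :: "real ^ 'p"
    and m \<delta> c G Mt \<tau> \<mu> lam rhosq :: real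
    and M :: "real ^ 2 ^ 2"
    and P :: "'w measure"
    and idx :: "nat \<Rightarrow> 'w \<Rightarrow> nat"
    and x u e :: "nat \<Rightarrow> 'w \<Rightarrow> real ^ 'p"
    and \<alpha> \<zeta> :: "nat \<Rightarrow> real"
    and k :: nat
  assumes "n \<ge> 1"
    and "\<forall>i\<in>{1..n}. f i differentiable_on UNIV"
    and "\<forall>y. g y = 1 / real n * (\<Sum>i=1..n. f i y)"
    and "m > 0" and "g \<in> S_class m" and "global_minimizer g xs"
    and "case_I m n f xs M G \<or> case_II m n f xs M G \<or> case_III m n f xs M G \<or> case_IV m n f xs M G"
    and "Mt = M $ 1 $ 1 + 2 * m * M $ 1 $ 2"
    \<comment> \<open>the biased SGD process\<close>
    and "prob_space P"
    and "x 0 \<in> borel_measurable P" and "integrable P (\<lambda>\<omega>. (norm (x 0 \<omega>))\<^sup>2)"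
    and "prob_space.indep_vars P (\<lambda>_. count_space {1..n}) idx UNIV"
    and "\<forall>j. distr P (count_space {1..n}) (idx j) = uniform_count_measure {1..n}"
    and "\<forall>j. indep_rv P borel (x j) (count_space {1..n}) (idx j)"
    and "\<forall>j. \<forall>\<omega>\<in>space P. u j \<omega> = grad (f (idx j \<omega>)) (x j \<omega>)"
    and "\<forall>j. \<forall>\<omega>\<in>space P. x (Suc j) \<omega> = x j \<omega> - \<alpha> j *\<^sub>R (u j \<omega> + e j \<omega>)"
    and "\<forall>j. e j \<in> borel_measurable P"
    and "\<delta> \<ge> 0" and "c \<ge> 0"
    and "\<forall>j. AE \<omega> in P. (norm (e j \<omega>))\<^sup>2 \<le> \<delta>\<^sup>2 * (norm (u j \<omega>))\<^sup>2 + c\<^sup>2"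
    \<comment> \<open>the stepsize and the parameter at iteration \<open>k\<close>\<close>
    and "\<alpha> k > 0" and "M $ 2 $ 1 * \<alpha> k \<le> 1" and "\<delta> > 0 \<longrightarrow> M $ 2 $ 1 * \<alpha> k < 1"
    and "\<tau> = (if \<delta> > 0 then \<alpha> k * M $ 2 $ 1 * \<delta>\<^sup>2 / (1 - \<alpha> k * M $ 2 $ 1) else 0)"
    and "\<zeta> k > 0" and "\<zeta> k \<ge> \<tau>"
    and "\<mu> = (\<alpha> k)\<^sup>2 * (1 + inverse (\<zeta> k))"
    and "lam = (\<alpha> k)\<^sup>2 * (1 + \<zeta> k) * (1 + \<delta>\<^sup>2 * inverse (\<zeta> k))"
    and "rhosq = (1 + \<zeta> k) * (1 - 2 * m * \<alpha> k + Mt * (\<alpha> k)\<^sup>2 * (1 + \<delta>\<^sup>2 * inverse (\<zeta> k)))"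
  shows "\<mu> \<ge> 0 \<and> lam \<ge> 0 \<and> rhosq \<ge> 0 \<and>
    integrable P (\<lambda>\<omega>. (norm (x k \<omega> - xs))\<^sup>2) \<and>
    integrable P (\<lambda>\<omega>. (norm (x (Suc k) \<omega> - xs))\<^sup>2) \<and>
    prob_space.expectation P (\<lambda>\<omega>. (norm (x (Suc k) \<omega> - xs))\<^sup>2)
      \<le> rhosq * prob_space.expectation P (\<lambda>\<omega>. (norm (x k \<omega> - xs))\<^sup>2) + (2 * lam * G\<^sup>2 + \<mu> * c\<^sup>2)"
proof -
  interpret prob_space P by fact
  note n = assms(1) and diff = assms(2) and g = assms(3) and m = assms(4) and S = assms(5)
    and min = assms(6) and cs = assms(7) and Mt = assms(8) and x0 = assms(11)
    and dist = assms(13) and indep = assms(14) and u = assms(15) and step = assms(16)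
    and \<delta> = assms(18) and e = assms(20) and \<alpha> = assms(21,22,23)
    and \<tau> = assms(24) and \<zeta> = assms(25,26) and defs = assms(27,28,29)
  have x_meas: "x j \<in> borel_measurable P" for j
    using indep unfolding indep_rv_def by blast
  have idx: "idx j \<omega> \<in> {1..n}" if "\<omega> \<in> space P" for j \<omega>
  proof -
    have "idx j \<in> measurable P (count_space {1..n})"
      using indep unfolding indep_rv_def by blast
    from measurable_space[OF this that] show ?thesis by simp
  qed
  have gg: "(\<Sum>i=1..n. grad (f i) y) = real n *\<^sub>R grad g y" for y
    using grad_mean[OF diff g, of y] n by simp
  have gdiff: "g differentiable_on UNIV"
    using S unfolding S_class_def by blast
  have zero: "(\<Sum>i=1..n. grad (f i) xs) = 0"
    using gg grad_global_minimizer[OF gdiff min] by simp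
  have mono: "real n * (m * (norm (y - xs))\<^sup>2) \<le> (y - xs) \<bullet> (\<Sum>i=1..n. grad (f i) y)" for y
    unfolding gg using S_class_global_minimizer[OF S m min, of y] by (simp add: mult_left_mono)
  note cb = case_bounds[OF n m zero mono cs]
  obtain A B where AB: "\<And>i y. i \<in> {1..n} \<Longrightarrow> (norm (grad (f i) y))\<^sup>2 \<le> A * (norm (y - xs))\<^sup>2 + B"
    using cb(4) by blast

  let ?a = "\<alpha> k" and ?z = "\<zeta> k"
  have mu: "\<mu> \<ge> 0" and la: "lam \<ge> 0"
    using \<zeta>(1) unfolding defs by simp_all
  have rho: "rhosq \<ge> 0"
  proof -
    \<comment> \<open>The second factor of \<open>rhosq\<close> dominates
      \<open>(1 - m * ?a)\<^sup>2\<close>, since \<open>Mt\<close> is at least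
      \<open>m\<^sup>2\<close> and its multiplier is at least 1.\<close>
    have "0 \<le> (1 - m * ?a)\<^sup>2" by simp
    also have "\<dots> = 1 - 2 * m * ?a + m\<^sup>2 * ?a\<^sup>2"
      by (simp add: power2_eq_square algebra_simps)
    also have "m\<^sup>2 * ?a\<^sup>2 \<le> Mt * ?a\<^sup>2 * 1"
      using cb(2) Mt by (simp add: mult_right_mono)
    also have "Mt * ?a\<^sup>2 * 1 \<le> Mt * ?a\<^sup>2 * (1 + \<delta>\<^sup>2 * inverse ?z)"
    proof (rule mult_left_mono)
      have "0 \<le> Mt" using cb(2) Mt by (smt (verit) zero_le_power2)
      then show "0 \<le> Mt * ?a\<^sup>2" by simp
    qed (use \<zeta>(1) in simp)
    finally show ?thesis using \<zeta>(1) unfolding defs by simp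
  qed
  \<comment> \<open>After cancelling \<open>?a * (1 + ?z)\<close> and multiplying by
    \<open>?z\<close>, this is the claim
    \<open>?a * M $ 1 $ 2 * (?z + \<delta>\<^sup>2) \<le> ?z\<close>. For positive \<delta> it
    rearranges the lower bound \<tau> on \<open>?z\<close>; for \<delta> = 0 it is the stepsize
    condition.\<close>
  have coeff: "lam * M $ 1 $ 2 \<le> ?a * (1 + ?z)"
  proof -
    have "?a * M $ 1 $ 2 * (?z + \<delta>\<^sup>2) \<le> ?z"
    proof (cases "\<delta> > 0")
      case True
      then have "?a * M $ 1 $ 2 * \<delta>\<^sup>2 \<le> ?z * (1 - ?a * M $ 1 $ 2)"
        using \<alpha>(3) \<tau> \<zeta>(2) cb(1) by (simp add: pos_divide_le_eq mult.commute)
      then show ?thesis by (simp add: algebra_simps)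
    next
      case False
      then show ?thesis
        using \<delta> \<alpha>(2) \<zeta>(1) cb(1) mult_right_mono[of "?a * M $ 1 $ 2" 1 ?z] by (simp add: mult.commute)
    qed
    then have "?a * M $ 1 $ 2 * (1 + \<delta>\<^sup>2 * inverse ?z) \<le> 1"
      using \<zeta>(1) by (simp add: field_simps)
    then have "(?a * (1 + ?z)) * (?a * M $ 1 $ 2 * (1 + \<delta>\<^sup>2 * inverse ?z)) \<le> (?a * (1 + ?z)) * 1"
      using \<alpha>(1) \<zeta>(1) by (intro mult_left_mono) auto
    then show ?thesis unfolding defs by (simp add: power2_eq_square algebra_simps)
  qed

  \<comment> \<open>The Young parameter is left free: positivity of \<open>\<zeta> j\<close> is
    known only at \<open>j = k\<close>. The value 1 serves for integrability at every
    \<open>j\<close>, and \<open>\<zeta> k\<close> for the recursion itself.\<close>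
  have step_le: "AE \<omega> in P. (norm (x (Suc j) \<omega> - xs))\<^sup>2
      \<le> (1 + z) * (norm (x j \<omega> - xs - \<alpha> j *\<^sub>R u j \<omega>))\<^sup>2
        + (\<alpha> j)\<^sup>2 * (1 + inverse z) * (\<delta>\<^sup>2 * (norm (u j \<omega>))\<^sup>2 + c\<^sup>2)" if z: "z > 0" for j z
    using e[rule_format, of j]
  proof (rule AE_mp, intro AE_I2 impI)
    fix \<omega> assume w: "\<omega> \<in> space P"
      and le: "(norm (e j \<omega>))\<^sup>2 \<le> \<delta>\<^sup>2 * (norm (u j \<omega>))\<^sup>2 + c\<^sup>2"
    have eq: "x (Suc j) \<omega> - xs = (x j \<omega> - xs - \<alpha> j *\<^sub>R u j \<omega>) - \<alpha> j *\<^sub>R e j \<omega>"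
      using step w by (simp add: algebra_simps)
    have "(norm (x (Suc j) \<omega> - xs))\<^sup>2 \<le> (1 + z) * (norm (x j \<omega> - xs - \<alpha> j *\<^sub>R u j \<omega>))\<^sup>2
        + (\<alpha> j)\<^sup>2 * (1 + inverse z) * (norm (e j \<omega>))\<^sup>2"
      unfolding eq by (rule norm_diff_scaled_sq_le[OF z])
    also have "\<dots> \<le> (1 + z) * (norm (x j \<omega> - xs - \<alpha> j *\<^sub>R u j \<omega>))\<^sup>2
        + (\<alpha> j)\<^sup>2 * (1 + inverse z) * (\<delta>\<^sup>2 * (norm (u j \<omega>))\<^sup>2 + c\<^sup>2)"
      using z le by (intro add_left_mono mult_left_mono) auto
    finally show "(norm (x (Suc j) \<omega> - xs))\<^sup>2 \<le> (1 + z) * (norm (x j \<omega> - xs - \<alpha> j *\<^sub>R u j \<omega>))\<^sup>2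
        + (\<alpha> j)\<^sup>2 * (1 + inverse z) * (\<delta>\<^sup>2 * (norm (u j \<omega>))\<^sup>2 + c\<^sup>2)" .
  qed

  \<comment> \<open>The Bochner integral of a non-integrable function is 0 by convention, so finite
    second moments must be established before expectations are compared. The induction uses no sign
    of \<open>\<alpha> j\<close>.\<close>
  have int: "integrable P (\<lambda>\<omega>. (norm (x j \<omega> - xs))\<^sup>2)" for j
  proof (induction j)
    case 0
    have "integrable P (\<lambda>\<omega>. 2 * (norm (x 0 \<omega>))\<^sup>2 + 2 * (norm xs)\<^sup>2)"
      using x0 by simp
    then show ?case
    proof (rule Bochner_Integration.integrable_bound)
      show "AE \<omega> in P. norm ((norm (x 0 \<omega> - xs))\<^sup>2) \<le> norm (2 * (norm (x 0 \<omega>))\<^sup>2 + 2 * (norm xs)\<^sup>2)"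
        using norm_add_sq_le[of _ "- xs"] by (intro AE_I2) simp
    qed (use x_meas[of 0] in measurable)
  next
    case (Suc j)
    \<comment> \<open>With Young parameter 1 both prefactors in \<open>step_le\<close> involve 2.
      The summand \<open>4 * (\<alpha> j)\<^sup>2\<close> comes from splitting the unbiased step
      once more, the other summand from the bound on \<open>e j\<close>.\<close>
    let ?C = "4 * (\<alpha> j)\<^sup>2 + 2 * (\<alpha> j)\<^sup>2 * \<delta>\<^sup>2"
    have "integrable P (\<lambda>\<omega>. 4 * (norm (x j \<omega> - xs))\<^sup>2
        + ?C * (A * (norm (x j \<omega> - xs))\<^sup>2 + B) + 2 * (\<alpha> j)\<^sup>2 * c\<^sup>2)"
      using Suc by simp
    then show ?case
    proof (rule Bochner_Integration.integrable_bound)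
      show "AE \<omega> in P. norm ((norm (x (Suc j) \<omega> - xs))\<^sup>2) \<le> norm (4 * (norm (x j \<omega> - xs))\<^sup>2
        + ?C * (A * (norm (x j \<omega> - xs))\<^sup>2 + B) + 2 * (\<alpha> j)\<^sup>2 * c\<^sup>2)"
        using step_le[of 1 j, simplified]
      proof (rule AE_mp, intro AE_I2 impI)
        fix \<omega> assume w: "\<omega> \<in> space P"
          and le: "(norm (x (Suc j) \<omega> - xs))\<^sup>2 \<le> 2 * (norm (x j \<omega> - xs - \<alpha> j *\<^sub>R u j \<omega>))\<^sup>2
            + (\<alpha> j)\<^sup>2 * 2 * (\<delta>\<^sup>2 * (norm (u j \<omega>))\<^sup>2 + c\<^sup>2)"
        have "(norm (x j \<omega> - xs - \<alpha> j *\<^sub>R u j \<omega>))\<^sup>2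
            \<le> 2 * (norm (x j \<omega> - xs))\<^sup>2 + 2 * ((\<alpha> j)\<^sup>2 * (norm (u j \<omega>))\<^sup>2)"
          using norm_add_sq_le[of "x j \<omega> - xs" "- (\<alpha> j *\<^sub>R u j \<omega>)"] by (simp add: power_mult_distrib)
        with le have "(norm (x (Suc j) \<omega> - xs))\<^sup>2
            \<le> 4 * (norm (x j \<omega> - xs))\<^sup>2 + ?C * (norm (u j \<omega>))\<^sup>2 + 2 * (\<alpha> j)\<^sup>2 * c\<^sup>2"
          by (simp add: algebra_simps)
        also have "?C * (norm (u j \<omega>))\<^sup>2 \<le> ?C * (A * (norm (x j \<omega> - xs))\<^sup>2 + B)"
          using AB[OF idx[OF w, of j], of "x j \<omega>"] u w by (intro mult_left_mono) auto
        finally show "norm ((norm (x (Suc j) \<omega> - xs))\<^sup>2) \<le> norm (4 * (norm (x j \<omega> - xs))\<^sup>2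
            + ?C * (A * (norm (x j \<omega> - xs))\<^sup>2 + B) + 2 * (\<alpha> j)\<^sup>2 * c\<^sup>2)"
          by simp
      qed
    qed (use x_meas[of "Suc j"] in measurable)
  qed

  \<comment> \<open>This is the Young bound with the squares expanded and the random index frozen at
    \<open>i\<close>, a function of the current iterate alone.\<close>
  define \<Phi> where "\<Phi> i y = (1 + ?z) * (norm (y - xs))\<^sup>2 - 2 * ?a * (1 + ?z) * ((y - xs) \<bullet> grad (f i) y)
      + lam * (norm (grad (f i) y))\<^sup>2 + \<mu> * c\<^sup>2" for i y
  have gm: "grad (f i) \<in> borel_measurable borel" if "i \<in> {1..n}" for i
    using borel_measurable_grad diff that by blast
  have \<Phi>_meas: "\<Phi> i \<in> borel_measurable borel" if "i \<in> {1..n}" for i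
    unfolding \<Phi>_def[abs_def] using gm[OF that] by measurable
  have \<Phi>_int: "integrable P (\<lambda>\<omega>. \<Phi> i (x k \<omega>))" if i: "i \<in> {1..n}" for i
  proof -
    have gx: "(\<lambda>\<omega>. grad (f i) (x k \<omega>)) \<in> borel_measurable P"
      by (rule measurable_compose[OF x_meas gm[OF i]])
    \<comment> \<open>One majorant serves both the squared gradient and the inner product, as the
      latter is at most the sum of the two squared norms.\<close>
    have dom: "integrable P (\<lambda>\<omega>. A * (norm (x k \<omega> - xs))\<^sup>2 + B + (norm (x k \<omega> - xs))\<^sup>2)"
      using int[of k] by simp
    have i1: "integrable P (\<lambda>\<omega>. (norm (grad (f i) (x k \<omega>)))\<^sup>2)"
      using dom
    proof (rule Bochner_Integration.integrable_bound)
      show "AE \<omega> in P. norm ((norm (grad (f i) (x k \<omega>)))\<^sup>2)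
          \<le> norm (A * (norm (x k \<omega> - xs))\<^sup>2 + B + (norm (x k \<omega> - xs))\<^sup>2)"
      proof (rule AE_I2)
        fix \<omega>
        show "norm ((norm (grad (f i) (x k \<omega>)))\<^sup>2)
          \<le> norm (A * (norm (x k \<omega> - xs))\<^sup>2 + B + (norm (x k \<omega> - xs))\<^sup>2)"
          using AB[OF i, of "x k \<omega>"] zero_le_power2[of "norm (x k \<omega> - xs)"]
          unfolding real_norm_def abs_power2 by linarith
      qed
    qed (use gx in measurable)
    have i2: "integrable P (\<lambda>\<omega>. (x k \<omega> - xs) \<bullet> grad (f i) (x k \<omega>))"
      using dom
    proof (rule Bochner_Integration.integrable_bound)
      show "AE \<omega> in P. norm ((x k \<omega> - xs) \<bullet> grad (f i) (x k \<omega>))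
          \<le> norm (A * (norm (x k \<omega> - xs))\<^sup>2 + B + (norm (x k \<omega> - xs))\<^sup>2)"
      proof (rule AE_I2)
        fix \<omega>
        let ?v = "x k \<omega> - xs" and ?w = "grad (f i) (x k \<omega>)"
        have "\<bar>?v \<bullet> ?w\<bar> \<le> norm ?v * norm ?w" by (rule Cauchy_Schwarz_ineq2)
        also have "\<dots> \<le> (norm ?v)\<^sup>2 + (norm ?w)\<^sup>2"
          using sum_squares_bound[of "norm ?v" "norm ?w"]
            mult_nonneg_nonneg[OF norm_ge_zero[of ?v] norm_ge_zero[of ?w]]
          unfolding mult.assoc by linarith
        also have "\<dots> \<le> A * (norm ?v)\<^sup>2 + B + (norm ?v)\<^sup>2"
          using AB[OF i, of "x k \<omega>"] by simp
        finally show "norm (?v \<bullet> ?w) \<le> norm (A * (norm ?v)\<^sup>2 + B + (norm ?v)\<^sup>2)" by simp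
      qed
    qed (use gx x_meas[of k] in measurable)
    show ?thesis unfolding \<Phi>_def using i1 i2 int[of k] by simp
  qed
  note avg = integral_indep_uniform_index[OF n indep[rule_format, of k] dist[rule_format, of k] \<Phi>_meas \<Phi>_int]

  have mean_le: "1 / real n * (\<Sum>i=1..n. \<Phi> i y)
      \<le> rhosq * (norm (y - xs))\<^sup>2 + (2 * lam * G\<^sup>2 + \<mu> * c\<^sup>2)" for y
  proof -
    let ?s = "(norm (y - xs))\<^sup>2" and ?t = "(y - xs) \<bullet> grad g y"
    have nt: "(y - xs) \<bullet> (\<Sum>i=1..n. grad (f i) y) = real n * ?t"
      unfolding gg by simp
    have "(\<Sum>i=1..n. (norm (grad (f i) y))\<^sup>2) \<le> real n * (M $ 1 $ 1 * ?s + 2 * G\<^sup>2 + 2 * M $ 1 $ 2 * ?t)"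
      using cb(3)[of y] unfolding nt by (simp add: algebra_simps)
    then have q: "1 / real n * (\<Sum>i=1..n. (norm (grad (f i) y))\<^sup>2) \<le> M $ 1 $ 1 * ?s + 2 * G\<^sup>2 + 2 * M $ 1 $ 2 * ?t"
      using n by (simp add: pos_divide_le_eq mult.commute)
    have "(\<Sum>i=1..n. \<Phi> i y) = real n * ((1 + ?z) * ?s + \<mu> * c\<^sup>2)
        - 2 * ?a * (1 + ?z) * ((y - xs) \<bullet> (\<Sum>i=1..n. grad (f i) y))
        + lam * (\<Sum>i=1..n. (norm (grad (f i) y))\<^sup>2)"
      unfolding \<Phi>_def inner_sum_right sum_distrib_left
      by (simp add: sum.distrib sum_subtractf algebra_simps)
    then have "1 / real n * (\<Sum>i=1..n. \<Phi> i y) = (1 + ?z) * ?s + \<mu> * c\<^sup>2 - 2 * ?a * (1 + ?z) * ?t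
        + lam * (1 / real n * (\<Sum>i=1..n. (norm (grad (f i) y))\<^sup>2))"
      unfolding nt using n by (simp add: field_simps)
    also have "\<dots> \<le> (1 + ?z) * ?s + \<mu> * c\<^sup>2 - 2 * ?a * (1 + ?z) * ?t
        + lam * (M $ 1 $ 1 * ?s + 2 * G\<^sup>2 + 2 * M $ 1 $ 2 * ?t)"
      using mult_left_mono[OF q la] by simp
    also have "\<dots> = (1 + ?z) * ?s + lam * M $ 1 $ 1 * ?s + (2 * lam * G\<^sup>2 + \<mu> * c\<^sup>2)
        - 2 * ((?a * (1 + ?z) - lam * M $ 1 $ 2) * ?t)"
      by (simp add: algebra_simps)
    \<comment> \<open>By \<open>coeff\<close> the bracket is nonnegative, so decreasing
      \<open>?t\<close> to \<open>m * ?s\<close> can only increase the whole expression.\<close>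
    also have "\<dots> \<le> (1 + ?z) * ?s + lam * M $ 1 $ 1 * ?s + (2 * lam * G\<^sup>2 + \<mu> * c\<^sup>2)
        - 2 * ((?a * (1 + ?z) - lam * M $ 1 $ 2) * (m * ?s))"
    proof -
      have "(?a * (1 + ?z) - lam * M $ 1 $ 2) * (m * ?s) \<le> (?a * (1 + ?z) - lam * M $ 1 $ 2) * ?t"
        using coeff S_class_global_minimizer[OF S m min, of y] by (intro mult_left_mono) auto
      then show ?thesis by simp
    qed
    also have "\<dots> = rhosq * ?s + (2 * lam * G\<^sup>2 + \<mu> * c\<^sup>2)"
      unfolding defs Mt by (simp add: algebra_simps)
    finally show ?thesis .
  qed

  have "AE \<omega> in P. (norm (x (Suc k) \<omega> - xs))\<^sup>2 \<le> \<Phi> (idx k \<omega>) (x k \<omega>)"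
    using step_le[OF \<zeta>(1), of k]
  proof (rule AE_mp, intro AE_I2 impI)
    fix \<omega> assume w: "\<omega> \<in> space P"
    let ?v = "x k \<omega> - xs" and ?u = "u k \<omega>"
    assume le: "(norm (x (Suc k) \<omega> - xs))\<^sup>2 \<le> (1 + ?z) * (norm (?v - ?a *\<^sub>R ?u))\<^sup>2
        + ?a\<^sup>2 * (1 + inverse ?z) * (\<delta>\<^sup>2 * (norm ?u)\<^sup>2 + c\<^sup>2)"
    have sq: "(norm (?v - ?a *\<^sub>R ?u))\<^sup>2 = (norm ?v)\<^sup>2 - 2 * ?a * (?v \<bullet> ?u) + ?a\<^sup>2 * (norm ?u)\<^sup>2"
      by (rule norm_diff_scaled_sq)
    \<comment> \<open>This splits \<open>lam\<close> into the contribution of the unbiased step and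
      that of the relative error, using
      \<open>(1 + ?z) * inverse ?z = 1 + inverse ?z\<close>.\<close>
    have lam: "lam = ?a\<^sup>2 * (1 + ?z) + ?a\<^sup>2 * (1 + inverse ?z) * \<delta>\<^sup>2"
      using \<zeta>(1) unfolding defs by (simp add: field_simps)
    have "(1 + ?z) * (norm (?v - ?a *\<^sub>R ?u))\<^sup>2 + ?a\<^sup>2 * (1 + inverse ?z) * (\<delta>\<^sup>2 * (norm ?u)\<^sup>2 + c\<^sup>2)
        = (1 + ?z) * (norm ?v)\<^sup>2 - 2 * ?a * (1 + ?z) * (?v \<bullet> ?u) + lam * (norm ?u)\<^sup>2 + \<mu> * c\<^sup>2"
      unfolding sq lam defs(1) by (simp only: distrib_left distrib_right left_diff_distrib right_diff_distrib ac_simps)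
    then show "(norm (x (Suc k) \<omega> - xs))\<^sup>2 \<le> \<Phi> (idx k \<omega>) (x k \<omega>)"
      using le u w unfolding \<Phi>_def by simp
  qed
  then have "expectation (\<lambda>\<omega>. (norm (x (Suc k) \<omega> - xs))\<^sup>2) \<le> expectation (\<lambda>\<omega>. \<Phi> (idx k \<omega>) (x k \<omega>))"
    by (intro integral_mono_AE int avg(1)) auto
  also have "\<dots> = expectation (\<lambda>\<omega>. 1 / real n * (\<Sum>i=1..n. \<Phi> i (x k \<omega>)))"
    by (rule avg(2)) auto
  also have "\<dots> \<le> expectation (\<lambda>\<omega>. rhosq * (norm (x k \<omega> - xs))\<^sup>2 + (2 * lam * G\<^sup>2 + \<mu> * c\<^sup>2))"
  proof (rule integral_mono)
    show "integrable P (\<lambda>\<omega>. 1 / real n * (\<Sum>i=1..n. \<Phi> i (x k \<omega>)))"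
      by (intro integrable_mult_right Bochner_Integration.integrable_sum \<Phi>_int)
    show "integrable P (\<lambda>\<omega>. rhosq * (norm (x k \<omega> - xs))\<^sup>2 + (2 * lam * G\<^sup>2 + \<mu> * c\<^sup>2))"
      using int[of k] by simp
  qed (rule mean_le)
  also have "\<dots> = rhosq * expectation (\<lambda>\<omega>. (norm (x k \<omega> - xs))\<^sup>2) + (2 * lam * G\<^sup>2 + \<mu> * c\<^sup>2)"
    using int[of k] by (simp add: prob_space)
  finally show ?thesis
    using mu la rho int by blast
qed

end
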